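(* Let $c=(c_1,\dots,c_N)\in\mathbb C^N$ with $c_1+c_2+\cdots+c_N=1$, and for $j=1,\dots,N$ let $\varphi_j(x)=\frac{|x|!}{x!}\,c^{\,x+e^j}$ for $x\in\mathbb Z^N_\geqslant$. Then for any $\mu\in\mathbb Z^n$ $$\sum_{j=1}^{N}\ \sum_{\nu\in K_j}P_{A_j}(\nu)\,P_A(\mu-\nu;\varphi_j)=P_A(\mu).$$ (For each $\mu$ only finitely many terms of the sum on the left are nonzero.)
   Context: Let $\alpha^1,\dots,\alpha^N\in\mathbb Z^n$ be column vectors and $A=[\alpha^1,\dots,\alpha^N]$ the $n\times N$ matrix with these columns. It is assumed that the cone $K=\{x_1\alpha^1+\cdots+x_N\alpha^N: x\in\mathbb R^N,\ x_j\ge0\}$ is pointed, in the sense that $\alpha^1,\dots,\alpha^N$ all lie in an open half-space $\{v\in\mathbb R^n:\ell(v)>0\}$ for some linear functional $\ell$. $\mathbb Z^N_\geqslant$ is the set of integer vectors with non-negative coordinates; $e^1,\dots,e^N$ is the standard basis of $\mathbb Z^N$. For $j=1,\dots,N$: $A_j=[\alpha^1,\dots,\alpha^{j-1},\alpha^{j+1},\dots,\alpha^N]$ is the matrix $A$ with its $j$-th column removed, and $K_j=\{\sum_{i\ne j}y_i\alpha^i:\ y_i\in\mathbb Z,\ y_i\ge0\}\subset\mathbb Z^n$ is the set of non-negative integer combinations of the remaining vectors. For a matrix $B$ with $M$ columns (each among the $\alpha^i$) and $\lambda\in\mathbb Z^n$, $P_B(\lambda)=\#\{x\in\mathbb Z^M_\geqslant: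 Bx=\lambda\}$ (vector partition function). For $\psi:\mathbb Z^N_\geqslant\to\mathbb C$, $P_A(\lambda;\psi)=\sum_{x\in\mathbb Z^N_\geqslant,\ Ax=\lambda}\psi(x)$ (a finite sum, equal to $0$ if there is no such $x$). Multi-index notation: $|x|=x_1+\cdots+x_N$, $x!=x_1!\cdots x_N!$, $c^x=c_1^{x_1}\cdots c_N^{x_N}$ (with $0^0=1$). *)

theory Defs
  imports "HOL-Analysis.Infinite_Sum" "Jordan_Normal_Form.Matrix"
begin

text \<open>Rows, columns and coordinates are numbered from 0, as usual for matrices and vectors with
  explicit carriers.\<close>

definition linear_functional :: "nat \<Rightarrow> (real vec \<Rightarrow> real) \<Rightarrow> bool" where
  "linear_functional n l \<longleftrightarrow>
     (\<forall>v \<in> carrier_vec n. \<forall>w \<in> carrier_vec n. l (v + w) = l v + l w) \<and>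
     (\<forall>a. \<forall>v \<in> carrier_vec n. l (a \<cdot>\<^sub>v v) = a * l v)"

definition pointed :: "int mat \<Rightarrow> bool" where
  "pointed A \<longleftrightarrow>
     (\<exists>l. linear_functional (dim_row A) l \<and>
          (\<forall>j < dim_col A. l (map_vec real_of_int (col A j)) > 0))"

definition nonneg_vecs :: "nat \<Rightarrow> int vec set" where
  "nonneg_vecs m = {x \<in> carrier_vec m. \<forall>i < m. 0 \<le> x $ i}"

definition delete_col :: "'a mat \<Rightarrow> nat \<Rightarrow> 'a mat" where
  "delete_col A j =
     mat (dim_row A) (dim_col A - 1) (\<lambda>(r, i). A $$ (r, if i < j then i else Suc i))"

definition nonneg_int_combinations :: "int mat \<Rightarrow> int vec set" where
  "nonneg_int_combinations B = {B *\<^sub>v y | y. y \<in> nonneg_vecs (dim_col B)}"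

text \<open>The sets of solutions in the next two definitions are finite when the matrix is pointed;
  for other matrices the values carry no meaning.\<close>

definition vector_partition :: "int mat \<Rightarrow> int vec \<Rightarrow> nat" where
  "vector_partition B v = card {x \<in> nonneg_vecs (dim_col B). B *\<^sub>v x = v}"

definition weighted_partition :: "int mat \<Rightarrow> int vec \<Rightarrow> (int vec \<Rightarrow> complex) \<Rightarrow> complex" where
  "weighted_partition A v \<psi> = (\<Sum>x | x \<in> nonneg_vecs (dim_col A) \<and> A *\<^sub>v x = v. \<psi> x)"

text \<open>Multi-index notation. These are used only for vectors with non-negative entries, on which the
  conversion to natural numbers loses nothing.\<close>

definition mi_abs :: "int vec \<Rightarrow> nat" where
  "mi_abs x = (\<Sum>i < dim_vec x. nat (x $ i))"

definition mi_fact :: "int vec \<Rightarrow> nat" where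
  "mi_fact x = (\<Prod>i < dim_vec x. fact (nat (x $ i)))"

definition mi_power :: "complex vec \<Rightarrow> int vec \<Rightarrow> complex" where
  "mi_power c x = (\<Prod>i < dim_vec x. (c $ i) ^ nat (x $ i))"

definition phi :: "complex vec \<Rightarrow> nat \<Rightarrow> int vec \<Rightarrow> complex" where
  "phi c j x =
     fact (mi_abs x) / of_nat (mi_fact x) * mi_power c (x + unit_vec (dim_vec x) j)"

end

theory Submission
  imports Defs
begin

text \<open>Let a walk start at the origin of \<open>\<int>\<^sup>N\<close> and take the step \<open>e\<^sub>j\<close> with (complex) weight \<open>c\<^sub>j\<close>.
  The weight of all paths that leave the box \<open>[0, z]\<close> from \<open>x\<close> in direction \<open>j\<close> is
  \<open>\<phi>\<^sub>j(x)\<close> with \<open>x\<^sub>j = z\<^sub>j\<close>; since the steps have total weight 1, the exit weights add up to 1.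
  Writing every solution of \<open>A z = \<mu>\<close> as \<open>z = x + y\<close> with \<open>y\<^sub>j = 0\<close> turns the left-hand side into
  the sum of these exit weights over all \<open>z\<close>, hence into the number of solutions.\<close>

subsection \<open>The weight of leaving a box\<close>

definition box :: "nat \<Rightarrow> int vec \<Rightarrow> int vec set" where
  "box N z = {x \<in> nonneg_vecs N. \<forall>i<N. x $ i \<le> z $ i}"

text \<open>For non-negative x the multinomial coefficient |x|!/x! counts the lattice paths from the
  origin to x, each of weight c^x. Hence this is the total weight of the paths ending in x.\<close>

definition walk_weight :: "complex vec \<Rightarrow> int vec \<Rightarrow> complex" where
  "walk_weight c x = fact (mi_abs x) / of_nat (mi_fact x) * mi_power c x"

lemma nonneg_vecs_carrier: "x \<in> nonneg_vecs N \<Longrightarrow> x \<in> carrier_vec N"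
  and nonneg_vecs_dim: "x \<in> nonneg_vecs N \<Longrightarrow> dim_vec x = N"
  and nonneg_vecs_index: "x \<in> nonneg_vecs N \<Longrightarrow> i < N \<Longrightarrow> 0 \<le> x $ i"
  by (auto simp: nonneg_vecs_def)

lemma finite_box: "finite (box N z)"
proof (rule finite_subset)
  show "box N z \<subseteq> vec N ` (PiE {..<N} (\<lambda>i. {0..z $ i}))"
  proof
    fix x assume x: "x \<in> box N z"
    then have "x = vec N (restrict (($) x) {..<N})"
      by (auto simp: box_def nonneg_vecs_def)
    moreover have "restrict (($) x) {..<N} \<in> PiE {..<N} (\<lambda>i. {0..z $ i})"
      using x by (auto simp: box_def nonneg_vecs_def)
    ultimately show "x \<in> vec N ` (PiE {..<N} (\<lambda>i. {0..z $ i}))" by (rule image_eqI)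
  qed
  show "finite (vec N ` (PiE {..<N} (\<lambda>i. {0..z $ i})))"
    by (intro finite_imageI finite_PiE) auto
qed

lemma mi_add_unit_vec:
  assumes x: "x \<in> nonneg_vecs N" and j: "j < N"
  shows "mi_abs (x + unit_vec N j) = Suc (mi_abs x)"
    and "mi_fact (x + unit_vec N j) = (nat (x $ j) + 1) * mi_fact x"
    and "mi_power c (x + unit_vec N j) = c $ j * mi_power c x"
proof -
  have dim: "dim_vec x = N" and pos: "0 \<le> x $ j" using x j by (auto simp: nonneg_vecs_def)
  have other: "(x + unit_vec N j) $ i = x $ i" if "i \<in> {..<N} - {j}" for i
    using that dim j by auto
  have at: "nat ((x + unit_vec N j) $ j) = Suc (nat (x $ j))" using pos dim j by auto
  show "mi_abs (x + unit_vec N j) = Suc (mi_abs x)"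
    unfolding mi_abs_def using dim other at
    by (simp del: index_add_vec(1) add: sum.remove[of "{..<N}" j] j)
  show "mi_fact (x + unit_vec N j) = (nat (x $ j) + 1) * mi_fact x"
    unfolding mi_fact_def using dim other at
    by (simp del: index_add_vec(1) add: prod.remove[of "{..<N}" j] j algebra_simps)
  show "mi_power c (x + unit_vec N j) = c $ j * mi_power c x"
    unfolding mi_power_def using dim other at
    by (simp del: index_add_vec(1) add: prod.remove[of "{..<N}" j] j)
qed

lemma mi_fact_pos: "0 < mi_fact x"
  unfolding mi_fact_def by (intro prod_pos) auto

text \<open>Read from its starting point, \<open>phi c j x\<close> is the weight of reaching x and
  then stepping in direction j.\<close>

lemma phi_eq_walk_weight:
  assumes "x \<in> nonneg_vecs N" and "j < N"
  shows "phi c j x = walk_weight c x * c $ j"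
  using mi_add_unit_vec(3)[OF assms, of c] nonneg_vecs_dim[OF assms(1)]
  by (simp add: phi_def walk_weight_def)

text \<open>The same step read from its end point y = x + e_j: since |y|! = |y| |x|! and y! = y_j
  x!, the factor y_j/|y| is the share of the paths to y whose last step is e_j.\<close>

lemma phi_eq_walk_weight_add_unit_vec:
  assumes x: "x \<in> nonneg_vecs N" and j: "j < N"
  shows "phi c j x =
    of_int ((x + unit_vec N j) $ j) / of_nat (mi_abs (x + unit_vec N j)) *
      walk_weight c (x + unit_vec N j)"
proof -
  have pos: "0 \<le> x $ j" and dim: "dim_vec x = N" using x j by (auto simp: nonneg_vecs_def)
  have e: "of_int ((x + unit_vec N j) $ j) = (of_nat (nat (x $ j) + 1) :: complex)"
  proof -
    have "(x + unit_vec N j) $ j = int (nat (x $ j) + 1)" using pos dim j by simp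
    then show ?thesis by (simp only: of_int_of_nat_eq)
  qed
  have nz: "(of_nat (nat (x $ j) + 1) :: complex) \<noteq> 0" "(of_nat (Suc (mi_abs x)) :: complex) \<noteq> 0"
    using of_nat_neq_0 by auto
  show ?thesis
    unfolding e phi_def walk_weight_def mi_add_unit_vec[OF x j] dim fact_Suc of_nat_mult
    using nz mi_fact_pos[of x] by (simp del: of_nat_Suc of_nat_add)
qed

text \<open>Away from the origin every path has exactly one last step, so the shares add up to 1. At
  the origin each quotient is 0/0, which HOL evaluates to 0; this is the right value, as no step
  ends there.\<close>

lemma sum_index_div_mi_abs:
  assumes "x \<in> nonneg_vecs N"
  shows "(\<Sum>j<N. of_int (x $ j) / of_nat (mi_abs x) :: complex) = (if x = 0\<^sub>v N then 0 else 1)"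
proof -
  have "(\<Sum>j<N. of_int (x $ j)) = (of_nat (mi_abs x) :: complex)"
    unfolding mi_abs_def of_nat_sum nonneg_vecs_dim[OF assms]
    using assms by (intro sum.cong) (auto simp: nonneg_vecs_def)
  then have "(\<Sum>j<N. of_int (x $ j) / of_nat (mi_abs x) :: complex)
      = of_nat (mi_abs x) / of_nat (mi_abs x)"
    by (simp flip: sum_divide_distrib)
  moreover have "mi_abs x = 0 \<longleftrightarrow> x = 0\<^sub>v N"
  proof -
    have "mi_abs x = 0 \<longleftrightarrow> (\<forall>i<N. nat (x $ i) = 0)"
      using nonneg_vecs_dim[OF assms] by (auto simp: mi_abs_def)
    also have "\<dots> \<longleftrightarrow> (\<forall>i<N. x $ i = 0)"
      using nonneg_vecs_index[OF assms] by force
    also have "\<dots> \<longleftrightarrow> x = 0\<^sub>v N"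
      using nonneg_vecs_dim[OF assms] by (auto simp: vec_eq_iff)
    finally show ?thesis .
  qed
  ultimately show ?thesis by simp
qed

text \<open>The steps in direction j that stay inside the box are indexed by their end points y = x
  + e_j instead of their starting points. Points with y_j = 0 are not such end points, but they may
  be added to the sum because the factor y_j kills their terms.\<close>

lemma sum_phi_inner:
  assumes "j < N"
  shows "(\<Sum>x | x \<in> box N z \<and> x $ j \<noteq> z $ j. phi c j x) =
    (\<Sum>y\<in>box N z. of_int (y $ j) / of_nat (mi_abs y) * walk_weight c y)"
proof (rule sum.reindex_bij_witness_not_neutral
    [where S' = "{}" and T' = "{y \<in> box N z. y $ j = 0}"
      and i = "\<lambda>y. y - unit_vec N j" and j = "\<lambda>x. x + unit_vec N j"])
  show "finite {y \<in> box N z. y $ j = 0}" using finite_box by simp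
  show "finite ({} :: int vec set)" by simp
  fix x assume "x \<in> {x \<in> box N z. x $ j \<noteq> z $ j} - {}"
  then have x: "x \<in> nonneg_vecs N" "\<And>i. i < N \<Longrightarrow> x $ i \<le> z $ i" "x $ j \<noteq> z $ j"
    by (auto simp: box_def)
  then have lt: "x $ j < z $ j" using assms by (simp add: order_less_le)
  show "x + unit_vec N j - unit_vec N j = x"
    using x assms by (auto simp: nonneg_vecs_def)
  show "x + unit_vec N j \<in> box N z - {y \<in> box N z. y $ j = 0}"
    using x lt assms by (auto simp: box_def nonneg_vecs_def unit_vec_def)
next
  fix x assume "x \<in> {x \<in> box N z. x $ j \<noteq> z $ j}"
  then have "x \<in> nonneg_vecs N" by (simp add: box_def)
  then show "of_int ((x + unit_vec N j) $ j) / of_nat (mi_abs (x + unit_vec N j)) *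
      walk_weight c (x + unit_vec N j) = phi c j x"
    by (rule phi_eq_walk_weight_add_unit_vec[OF _ assms, symmetric])
next
  fix y assume "y \<in> box N z - {y \<in> box N z. y $ j = 0}"
  then have y: "y \<in> nonneg_vecs N" "\<And>i. i < N \<Longrightarrow> y $ i \<le> z $ i" "y $ j \<noteq> 0"
    by (auto simp: box_def)
  then have gt: "y $ j > 0" "y $ j \<le> z $ j"
    using assms nonneg_vecs_index[OF y(1), of j] by auto
  show "y - unit_vec N j + unit_vec N j = y"
    using y assms by (auto simp: nonneg_vecs_def)
  have "(y - unit_vec N j) $ i \<le> z $ i" "0 \<le> (y - unit_vec N j) $ i" if "i < N" for i
    using y(2)[OF that] nonneg_vecs_index[OF y(1) that] nonneg_vecs_dim[OF y(1)] gt that assms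
    by (auto simp: unit_vec_def)
  moreover have "(y - unit_vec N j) $ j \<noteq> z $ j" using gt y(1) assms
    by (auto simp: nonneg_vecs_def)
  ultimately show "y - unit_vec N j \<in> {x \<in> box N z. x $ j \<noteq> z $ j} - {}"
    using y(1) by (auto simp: box_def nonneg_vecs_def simp del: index_minus_vec(1))
qed auto

text \<open>Conservation of weight: what flows out of the points of the box is their total weight,
  and what flows in along inner steps is the same total without the origin. The difference, the exit
  weight, is the weight of the origin.\<close>

lemma sum_phi_exit:
  assumes c: "(\<Sum>j<N. c $ j) = 1" and z: "z \<in> nonneg_vecs N"
  shows "(\<Sum>j<N. \<Sum>x | x \<in> box N z \<and> x $ j = z $ j. phi c j x) = 1"
proof -
  let ?B = "box N z" and ?w = "walk_weight c"
  have zero: "0\<^sub>v N \<in> ?B" using z by (auto simp: box_def nonneg_vecs_def)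
  have "(\<Sum>x\<in>?B. ?w x) = (\<Sum>x\<in>?B. \<Sum>j<N. ?w x * c $ j)"
    using c by (simp flip: sum_distrib_left)
  also have "\<dots> = (\<Sum>x\<in>?B. \<Sum>j<N. phi c j x)"
    by (intro sum.cong refl phi_eq_walk_weight[symmetric]) (auto simp: box_def)
  also have "\<dots> = (\<Sum>j<N. \<Sum>x\<in>?B. phi c j x)" by (rule sum.swap)
  \<comment> \<open>A step from x in direction j leaves the box exactly when x_j = z_j.\<close>
  also have "\<dots> = (\<Sum>j<N. (\<Sum>x | x \<in> ?B \<and> x $ j = z $ j. phi c j x) +
      (\<Sum>x | x \<in> ?B \<and> x $ j \<noteq> z $ j. phi c j x))"
    by (intro sum.cong refl, subst sum.union_disjoint[symmetric])
      (auto simp: finite_box intro!: sum.cong)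
  finally have total: "(\<Sum>x\<in>?B. ?w x) =
      (\<Sum>j<N. \<Sum>x | x \<in> ?B \<and> x $ j = z $ j. phi c j x) +
      (\<Sum>j<N. \<Sum>x | x \<in> ?B \<and> x $ j \<noteq> z $ j. phi c j x)"
    by (simp add: sum.distrib)
  have "(\<Sum>j<N. \<Sum>x | x \<in> ?B \<and> x $ j \<noteq> z $ j. phi c j x) =
      (\<Sum>j<N. \<Sum>y\<in>?B. of_int (y $ j) / of_nat (mi_abs y) * ?w y)"
    by (intro sum.cong refl sum_phi_inner) auto
  also have "\<dots> = (\<Sum>y\<in>?B. \<Sum>j<N. of_int (y $ j) / of_nat (mi_abs y) * ?w y)"
    by (rule sum.swap)
  \<comment> \<open>Collected at its end points, the inner flow restores the full weight of every
    point but the origin.\<close>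
  also have "\<dots> = (\<Sum>y\<in>?B. (if y = 0\<^sub>v N then 0 else 1) * ?w y)"
    unfolding sum_distrib_right[symmetric]
    by (intro sum.cong refl arg_cong2[where f = "(*)"] sum_index_div_mi_abs) (auto simp: box_def)
  also have "\<dots> = (\<Sum>y\<in>?B - {0\<^sub>v N}. ?w y)"
    by (intro sum.mono_neutral_cong_right) (auto simp: finite_box)
  also have "\<dots> = (\<Sum>y\<in>?B. ?w y) - ?w (0\<^sub>v N)"
    using zero by (simp add: sum_diff1 finite_box)
  \<comment> \<open>Only the empty path ends in the origin.\<close>
  also have "?w (0\<^sub>v N) = 1"
    by (simp add: walk_weight_def mi_abs_def mi_fact_def mi_power_def)
  finally show ?thesis using total by simp
qed

subsection \<open>Finiteness of the set of solutions\<close>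

text \<open>Additivity and homogeneity are given for two vectors at a time, so the sum over the
  columns is built up by induction.\<close>

lemma linear_functional_mult_mat_vec:
  assumes l: "linear_functional n l" and A: "A \<in> carrier_mat n N" and x: "x \<in> carrier_vec N"
  shows "l (map_vec real_of_int (A *\<^sub>v x)) =
    (\<Sum>i<N. of_int (x $ i) * l (map_vec real_of_int (col A i)))"
proof -
  \<comment> \<open>The combination of the first k columns, as a real vector.\<close>
  define v where "v k = vec n (\<lambda>r. \<Sum>i<k. real_of_int (A $$ (r, i) * x $ i))" for k
  have vc: "v k \<in> carrier_vec n" for k by (simp add: v_def)
  have add: "l (v + w) = l v + l w" if "v \<in> carrier_vec n" "w \<in> carrier_vec n" for v w
    using l that by (simp add: linear_functional_def)
  have scale: "l (a \<cdot>\<^sub>v v) = a * l v" if "v \<in> carrier_vec n" for a v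
    using l that by (simp add: linear_functional_def)
  have "l (v k) = (\<Sum>i<k. of_int (x $ i) * l (map_vec real_of_int (col A i)))" if "k \<le> N" for k
    using that
  proof (induction k)
    case 0
    \<comment> \<open>Writing the zero vector as 0 times itself lets homogeneity give the value
      0.\<close>
    have "v 0 = 0 \<cdot>\<^sub>v v 0" by (auto simp: v_def)
    then have "l (v 0) = 0 * l (v 0)" using scale[OF vc, of 0 0] by simp
    then show ?case by simp
  next
    case (Suc k)
    have "v (Suc k) = v k + of_int (x $ k) \<cdot>\<^sub>v map_vec real_of_int (col A k)"
      using A Suc.prems by (auto simp: v_def)
    moreover have "map_vec real_of_int (col A k) \<in> carrier_vec n" using A by auto
    ultimately have "l (v (Suc k)) = l (v k) + of_int (x $ k) * l (map_vec real_of_int (col A k))"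
      by (simp add: add scale vc)
    then show ?case using Suc by simp
  qed
  moreover have "map_vec real_of_int (A *\<^sub>v x) = v N"
    using A x by (auto simp: v_def scalar_prod_def atLeast0LessThan)
  ultimately show ?thesis by simp
qed

text \<open>Applying l to A x = v writes l(v) as a sum of non-negative terms x_i l(\<alpha>^i). Each
  term is at most l(v), which bounds x_i by l(v)/l(\<alpha>^i) and confines x to a box.\<close>

lemma finite_solutions:
  assumes A: "A \<in> carrier_mat n N" and "pointed A"
  shows "finite {x \<in> nonneg_vecs N. A *\<^sub>v x = v}"
proof -
  obtain l where l: "linear_functional n l"
    and pos: "\<And>j. j < N \<Longrightarrow> l (map_vec real_of_int (col A j)) > 0"
    using assms by (auto simp: pointed_def)
  let ?a = "\<lambda>i. l (map_vec real_of_int (col A i))"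
  let ?b = "vec N (\<lambda>i. \<lfloor>l (map_vec real_of_int v) / ?a i\<rfloor>)"
  have "{x \<in> nonneg_vecs N. A *\<^sub>v x = v} \<subseteq> box N ?b"
  proof
    fix x assume "x \<in> {x \<in> nonneg_vecs N. A *\<^sub>v x = v}"
    then have x: "x \<in> nonneg_vecs N" and "A *\<^sub>v x = v" by auto
    then have lv: "l (map_vec real_of_int v) = (\<Sum>i<N. of_int (x $ i) * ?a i)"
      using linear_functional_mult_mat_vec[OF l A] nonneg_vecs_carrier by blast
    have "of_int (x $ i) * ?a i \<le> l (map_vec real_of_int v)" if i: "i < N" for i
      unfolding lv
      by (rule member_le_sum)
        (use i pos nonneg_vecs_index[OF x] in \<open>auto intro!: mult_nonneg_nonneg simp: less_imp_le\<close>)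
    then have "x $ i \<le> ?b $ i" if "i < N" for i
      using that pos by (simp add: le_floor_iff pos_le_divide_eq)
    then show "x \<in> box N ?b" using x by (auto simp: box_def)
  qed
  then show ?thesis using finite_box by (rule finite_subset)
qed

subsection \<open>Deleting a column\<close>

definition insert_zero :: "nat \<Rightarrow> int vec \<Rightarrow> int vec" where
  "insert_zero j y = vec (Suc (dim_vec y))
     (\<lambda>i. if i < j then y $ i else if i = j then 0 else y $ (i - 1))"

text \<open>Vectors for the matrix with column j deleted are represented here inside \<int>^N, where
  they can be added to and subtracted from vectors for A.\<close>

definition face :: "nat \<Rightarrow> nat \<Rightarrow> int vec set" where
  "face N j = {y \<in> nonneg_vecs N. y $ j = 0}"

lemma bij_betw_insert_zero:
  assumes "j < N"
  shows "bij_betw (insert_zero j) (nonneg_vecs (N - 1)) (face N j)"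
proof (rule bij_betw_byWitness[where f' = "\<lambda>y. vec (N - 1) (\<lambda>i. y $ (if i < j then i else Suc i))"])
  show "\<forall>y\<in>nonneg_vecs (N - 1).
      vec (N - 1) (\<lambda>i. insert_zero j y $ (if i < j then i else Suc i)) = y"
    using assms by (auto simp: nonneg_vecs_def insert_zero_def)
  show "\<forall>y\<in>face N j. insert_zero j (vec (N - 1) (\<lambda>i. y $ (if i < j then i else Suc i))) = y"
    using assms by (auto simp: face_def nonneg_vecs_def insert_zero_def intro!: eq_vecI)
  show "insert_zero j ` nonneg_vecs (N - 1) \<subseteq> face N j"
    using assms by (auto simp: face_def nonneg_vecs_def insert_zero_def)
  show "(\<lambda>y. vec (N - 1) (\<lambda>i. y $ (if i < j then i else Suc i))) ` face N j \<subseteq> nonneg_vecs (N - 1)"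
    using assms by (auto simp: face_def nonneg_vecs_def)
qed

text \<open>In each row the two scalar products have the same terms, except for the term at j on the
  right, which the inserted zero annihilates.\<close>

lemma delete_col_mult_vec:
  assumes A: "A \<in> carrier_mat n N" and j: "j < N" and y: "y \<in> carrier_vec (N - 1)"
  shows "delete_col A j *\<^sub>v y = A *\<^sub>v insert_zero j y"
proof (rule eq_vecI)
  fix r assume "r < dim_vec (A *\<^sub>v insert_zero j y)"
  then have r: "r < n" using A by simp
  have "(\<Sum>i\<in>{0..<N - 1}. A $$ (r, if i < j then i else Suc i) * y $ i) =
      (\<Sum>i\<in>{0..<N}. A $$ (r, i) * insert_zero j y $ i)"
    by (rule sum.reindex_bij_witness_not_neutral
        [where S' = "{}" and T' = "{j}"
          and i = "\<lambda>i. if i < j then i else i - 1" and j = "\<lambda>i. if i < j then i else Suc i"])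
      (use j y in \<open>auto simp: insert_zero_def\<close>)
  then show "(delete_col A j *\<^sub>v y) $ r = (A *\<^sub>v insert_zero j y) $ r"
    using A j y r by (simp add: delete_col_def scalar_prod_def insert_zero_def)
qed (use A in \<open>auto simp: delete_col_def\<close>)

lemma nonneg_int_combinations_delete_col:
  assumes "A \<in> carrier_mat n N" and "j < N"
  shows "nonneg_int_combinations (delete_col A j) = (\<lambda>y. A *\<^sub>v y) ` face N j"
proof -
  have "nonneg_int_combinations (delete_col A j) = (\<lambda>y. delete_col A j *\<^sub>v y) ` nonneg_vecs (N - 1)"
    using assms by (auto simp: nonneg_int_combinations_def delete_col_def)
  also have "\<dots> = (\<lambda>y. A *\<^sub>v insert_zero j y) ` nonneg_vecs (N - 1)"
    using assms by (intro image_cong refl delete_col_mult_vec) (auto intro: nonneg_vecs_carrier)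
  also have "\<dots> = (\<lambda>y. A *\<^sub>v y) ` face N j"
    by (simp flip: bij_betw_imp_surj_on[OF bij_betw_insert_zero[OF assms(2)]] add: image_image)
  finally show ?thesis .
qed

lemma vector_partition_delete_col:
  assumes "A \<in> carrier_mat n N" and "j < N"
  shows "vector_partition (delete_col A j) v = card {y \<in> face N j. A *\<^sub>v y = v}"
proof -
  have d: "dim_col (delete_col A j) = N - 1" using assms by (simp add: delete_col_def)
  note bij = bij_betw_insert_zero[OF assms(2)]
  have image: "insert_zero j ` {y \<in> nonneg_vecs (N - 1). delete_col A j *\<^sub>v y = v}
      = {y \<in> face N j. A *\<^sub>v y = v}"
    unfolding bij_betw_imp_surj_on[OF bij, symmetric]
    using delete_col_mult_vec[OF assms] nonneg_vecs_carrier by auto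
  have inj: "inj_on (insert_zero j) {y \<in> nonneg_vecs (N - 1). delete_col A j *\<^sub>v y = v}"
    by (rule inj_on_subset[OF bij_betw_imp_inj_on[OF bij]]) auto
  show ?thesis
    unfolding vector_partition_def d image[symmetric] card_image[OF inj] ..
qed

subsection \<open>Regrouping the convolution\<close>

text \<open>The common index set of both ways of summing: a solution z together with a point x from
  which a step in direction j leaves the box [0, z].\<close>

definition exit_pairs :: "int mat \<Rightarrow> nat \<Rightarrow> int vec \<Rightarrow> nat \<Rightarrow> (int vec \<times> int vec) set" where
  "exit_pairs A N v j =
     (SIGMA z:{z \<in> nonneg_vecs N. A *\<^sub>v z = v}. {x \<in> box N z. x $ j = z $ j})"

lemma finite_exit_pairs:
  assumes "A \<in> carrier_mat n N" and "pointed A"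
  shows "finite (exit_pairs A N v j)"
  unfolding exit_pairs_def using finite_solutions[OF assms] finite_box by (intro finite_SigmaI) auto

lemma diff_in_face:
  assumes "(z, x) \<in> exit_pairs A N v j" and "j < N"
  shows "z - x \<in> face N j"
  using assms by (auto simp: exit_pairs_def box_def face_def nonneg_vecs_def)

text \<open>From y \<ge> 0 follows x \<le> y + x, and y_j = 0 makes this an equality in coordinate
  j. Together with \<open>diff_in_face\<close> this makes (y, x) and (y + x, x)
  interchangeable.\<close>

lemma add_in_exit_pairs:
  assumes A: "A \<in> carrier_mat n N" and j: "j < N" and v: "v \<in> carrier_vec n"
    and y: "y \<in> face N j" and x: "x \<in> nonneg_vecs N" and eq: "A *\<^sub>v x = v - A *\<^sub>v y"
  shows "(y + x, x) \<in> exit_pairs A N v j"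
proof -
  have c: "x \<in> carrier_vec N" "y \<in> carrier_vec N" using x y by (auto simp: face_def nonneg_vecs_def)
  have "A *\<^sub>v (y + x) = A *\<^sub>v y + (v - A *\<^sub>v y)"
    using mult_add_distrib_mat_vec[OF A c(2,1)] eq by simp
  also have "\<dots> = v" using A v by auto
  finally show ?thesis
    using x y c j by (auto simp: exit_pairs_def box_def face_def nonneg_vecs_def)
qed

text \<open>A count times a sum is a sum over pairs (y, x) with A y = u and A x = v - u. The
  substitution z = y + x turns these into the exit pairs whose difference is mapped to u.\<close>

lemma convolution_term:
  assumes A: "A \<in> carrier_mat n N" and p: "pointed A" and j: "j < N" and v: "v \<in> carrier_vec n"
  shows "of_nat (vector_partition (delete_col A j) u) * weighted_partition A (v - u) \<psi> =
    (\<Sum>(z, x) | (z, x) \<in> exit_pairs A N v j \<and> A *\<^sub>v (z - x) = u. \<psi> x)"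
proof -
  let ?Y = "{y \<in> face N j. A *\<^sub>v y = u}" and ?X = "{x \<in> nonneg_vecs N. A *\<^sub>v x = v - u}"
  have "of_nat (vector_partition (delete_col A j) u) * weighted_partition A (v - u) \<psi> =
      (\<Sum>(y, x)\<in>?Y \<times> ?X. \<psi> x)"
    using A by (simp add: vector_partition_delete_col[OF A j] weighted_partition_def
        sum.cartesian_product[symmetric])
  also have "\<dots> = (\<Sum>(z, x) | (z, x) \<in> exit_pairs A N v j \<and> A *\<^sub>v (z - x) = u. \<psi> x)"
  proof (rule sum.reindex_bij_witness
      [where i = "\<lambda>(z, x). (z - x, x)" and j = "\<lambda>(y, x). (y + x, x)"])
    fix a assume a: "a \<in> ?Y \<times> ?X"
    then obtain y x where yx: "a = (y, x)" "y \<in> face N j" "A *\<^sub>v y = u" "x \<in> nonneg_vecs N"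
      "A *\<^sub>v x = v - A *\<^sub>v y" by auto
    have canc: "y + x - x = y" using yx by (auto simp: face_def nonneg_vecs_def)
    then show "(case case a of (y, x) \<Rightarrow> (y + x, x) of (z, x) \<Rightarrow> (z - x, x)) = a"
      using yx by simp
    show "(case a of (y, x) \<Rightarrow> (y + x, x)) \<in>
        {(z, x). (z, x) \<in> exit_pairs A N v j \<and> A *\<^sub>v (z - x) = u}"
      using yx canc add_in_exit_pairs[OF A j v yx(2,4,5)] by simp
  next
    fix b assume "b \<in> {(z, x). (z, x) \<in> exit_pairs A N v j \<and> A *\<^sub>v (z - x) = u}"
    then obtain z x where zx: "b = (z, x)" "(z, x) \<in> exit_pairs A N v j" "A *\<^sub>v (z - x) = u"
      by auto
    then have z: "z \<in> carrier_vec N" "A *\<^sub>v z = v" and x: "x \<in> nonneg_vecs N" "x \<in> carrier_vec N"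
      by (auto simp: exit_pairs_def box_def nonneg_vecs_def)
    show "(case case b of (z, x) \<Rightarrow> (z - x, x) of (y, x) \<Rightarrow> (y + x, x)) = b"
      using zx z x by auto
    have "u = v - A *\<^sub>v x"
      using mult_minus_distrib_mat_vec[OF A z(1) x(2)] z zx by simp
    then have "A *\<^sub>v x = v - u" using A v by auto
    then show "(case b of (z, x) \<Rightarrow> (z - x, x)) \<in> ?Y \<times> ?X"
      using zx x diff_in_face[OF zx(2) j] by simp
  qed auto
  finally show ?thesis .
qed

text \<open>A term without exit pairs is an empty sum. As there are finitely many exit pairs, this
  yields both the finiteness claim and the reduction of the infinite sum to a finite one.\<close>

lemma convolution_support:
  assumes "A \<in> carrier_mat n N" and "pointed A" and "j < N" and "v \<in> carrier_vec n"
    and "of_nat (vector_partition (delete_col A j) u) * weighted_partition A (v - u) \<psi> \<noteq> 0"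
  shows "u \<in> (\<lambda>(z, x). A *\<^sub>v (z - x)) ` exit_pairs A N v j"
proof (rule ccontr)
  assume "u \<notin> (\<lambda>(z, x). A *\<^sub>v (z - x)) ` exit_pairs A N v j"
  then have "{(z, x). (z, x) \<in> exit_pairs A N v j \<and> A *\<^sub>v (z - x) = u} = {}" by force
  then show False using assms(5) unfolding convolution_term[OF assms(1-4)] by (simp only: sum.empty)
qed

lemma infsum_convolution:
  assumes A: "A \<in> carrier_mat n N" and p: "pointed A" and j: "j < N" and v: "v \<in> carrier_vec n"
  shows "(\<Sum>\<^sub>\<infinity>u\<in>nonneg_int_combinations (delete_col A j).
      of_nat (vector_partition (delete_col A j) u) * weighted_partition A (v - u) \<psi>) =
    (\<Sum>z | z \<in> nonneg_vecs N \<and> A *\<^sub>v z = v. \<Sum>x | x \<in> box N z \<and> x $ j = z $ j. \<psi> x)"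
    (is "infsum ?t ?K = _")
proof -
  let ?E = "exit_pairs A N v j" and ?g = "\<lambda>(z, x). A *\<^sub>v (z - x)"
  have fin: "finite ?E" using finite_exit_pairs[OF A p] .
  have "?g ` ?E \<subseteq> ?K"
    unfolding nonneg_int_combinations_delete_col[OF A j] using diff_in_face[OF _ j] by force
  then have "infsum ?t ?K = infsum ?t (?g ` ?E)"
    using convolution_support[OF A p j v] by (intro infsum_cong_neutral) blast+
  also have "\<dots> = (\<Sum>u\<in>?g ` ?E. ?t u)" using fin by simp
  \<comment> \<open>The terms are now sums over the fibres of \<open>?g\<close>, and these fibres
    partition the exit pairs.\<close>
  also have "\<dots> = (\<Sum>u\<in>?g ` ?E. \<Sum>a | a \<in> ?E \<and> ?g a = u. \<psi> (snd a))"
    unfolding convolution_term[OF A p j v] by (intro sum.cong refl) (auto simp: case_prod_unfold)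
  also have "\<dots> = (\<Sum>a\<in>?E. \<psi> (snd a))"
    using fin by (rule sum.image_gen[symmetric])
  also have "\<dots> = (\<Sum>z | z \<in> nonneg_vecs N \<and> A *\<^sub>v z = v. \<Sum>x | x \<in> box N z \<and> x $ j = z $ j. \<psi> x)"
    unfolding exit_pairs_def using finite_solutions[OF A p] finite_box
    by (subst sum.Sigma) (auto simp: case_prod_unfold)
  finally show ?thesis .
qed

theorem proposition1p4:
  fixes n N :: nat and A :: "int mat" and c :: "complex vec" and \<mu> :: "int vec"
  assumes "A \<in> carrier_mat n N"
    and "pointed A"
    and "c \<in> carrier_vec N"
    and "(\<Sum>j<N. c $ j) = 1"
    and "\<mu> \<in> carrier_vec n"
  shows "(\<forall>j<N. finite {\<nu> \<in> nonneg_int_combinations (delete_col A j).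
            of_nat (vector_partition (delete_col A j) \<nu>) *
              weighted_partition A (\<mu> - \<nu>) (phi c j) \<noteq> 0}) \<and>
         (\<Sum>j<N. \<Sum>\<^sub>\<infinity>\<nu>\<in>nonneg_int_combinations (delete_col A j).
            of_nat (vector_partition (delete_col A j) \<nu>) *
              weighted_partition A (\<mu> - \<nu>) (phi c j))
         = of_nat (vector_partition A \<mu>)"
proof (intro conjI allI impI)
  note A = assms(1,2)
  fix j assume j: "j < N"
  show "finite {\<nu> \<in> nonneg_int_combinations (delete_col A j).
      of_nat (vector_partition (delete_col A j) \<nu>) *
        weighted_partition A (\<mu> - \<nu>) (phi c j) \<noteq> 0}"
    by (rule finite_subset[OF _ finite_imageI[OF finite_exit_pairs[OF A]]])
      (use convolution_support[OF A j assms(5)] in blast)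
next
  note A = assms(1,2)
  let ?F = "{z \<in> nonneg_vecs N. A *\<^sub>v z = \<mu>}"
  have "(\<Sum>j<N. \<Sum>\<^sub>\<infinity>\<nu>\<in>nonneg_int_combinations (delete_col A j).
      of_nat (vector_partition (delete_col A j) \<nu>) *
        weighted_partition A (\<mu> - \<nu>) (phi c j)) =
      (\<Sum>j<N. \<Sum>z\<in>?F. \<Sum>x | x \<in> box N z \<and> x $ j = z $ j. phi c j x)"
    using infsum_convolution[OF A _ assms(5)] by simp
  \<comment> \<open>With the solution z fixed, the sum over all directions j is the total exit
    weight of the box [0, z], so each solution contributes 1.\<close>
  also have "\<dots> = (\<Sum>z\<in>?F. \<Sum>j<N. \<Sum>x | x \<in> box N z \<and> x $ j = z $ j. phi c j x)"
    by (rule sum.swap)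
  also have "\<dots> = (\<Sum>z\<in>?F. 1)"
    using sum_phi_exit[OF assms(4)] by (intro sum.cong) auto
  also have "\<dots> = of_nat (vector_partition A \<mu>)"
    using assms(1) by (simp add: vector_partition_def)
  finally show "(\<Sum>j<N. \<Sum>\<^sub>\<infinity>\<nu>\<in>nonneg_int_combinations (delete_col A j).
      of_nat (vector_partition (delete_col A j) \<nu>) *
        weighted_partition A (\<mu> - \<nu>) (phi c j)) = of_nat (vector_partition A \<mu>)" .
qed

end
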